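(* Let $m\in\mathbb N^{+}$ and $X>0$. In the one-dimensional high-contrast limit ($V_+=\infty$), the periodic arrangement in which all $m$ intervals where $V=0$ have the same length attains the maximum of $G_m$, and the maximal value is $G_m^\star=\frac65$. Explicitly: among all $\Omega\subset\mathbb R/X\mathbb Z$ that are unions of $m$ pairwise disjoint open intervals (with disjoint closures), the quantity $G_m^\infty(\Omega)$ has maximum $\frac65$, and this maximum is attained when all $m$ intervals have equal length.
   Context: For finite $V_+$ one considers the $m$-th gap-to-midgap ratio $G_m=\frac{\beta_m-\alpha_m}{(\alpha_m+\beta_m)/2}$ of $-\frac{d^2}{dx^2}+V$ with $X$-periodic $V$, where $\alpha_m=\max_kE_m(k)$, $\beta_m=\min_kE_{m+1}(k)$ and $E_j(k)$ is the $j$-th eigenvalue at quasi-momentum $k$; $V$ is a step function equal to $0$ on $m$ intervals per period and $V_+$ elsewhere. In the high-contrast limit $V_+=\infty$, the eigenvalues $E_j(k)$ are replaced by the Dirichlet eigenvalues $\lambda_1\le\lambda_2\le\cdots$ (with multiplicity) of $-\frac{d^2}{dx^2}$ on the set $\Omega=\{V=0\}$, so that $$G_m^\infty(\Omega)=2\,\frac{\lambda_{m+1}(\Omega)-\lambda_m(\Omega)}{\lambda_{m+1}(\Omega)+\lambda_m(\Omega)}.$$ *)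

theory Defs
  imports "HOL-Analysis.Analysis" "HOL-Library.Function_Algebras"
begin

text \<open>
  Subsets of the circle \<open>\<real>/X\<int>\<close> and functions on it are represented by their
  lifts to the real line, i.e. by \<open>X\<close>-periodic subsets of \<open>\<real>\<close> and
  \<open>X\<close>-periodic functions. The projection is an open map, so closures and interiors
  can be taken upstairs.
\<close>

definition circle_interval :: "real \<Rightarrow> real \<Rightarrow> real \<Rightarrow> real set" where
  "circle_interval X a b = (\<Union>k::int. {a + of_int k * X <..< b + of_int k * X})"

text \<open>
  The bound \<open>b i - a i \<le> X\<close> makes the projection injective on \<open>{a i<..<b i}\<close>. For
  \<open>m \<ge> 2\<close> disjointness of the closures forces strict inequality; for \<open>m = 1\<close> equality
  describes the circle with one point removed.
\<close>

definition interval_config :: "real \<Rightarrow> nat \<Rightarrow> (nat \<Rightarrow> real) \<Rightarrow> (nat \<Rightarrow> real) \<Rightarrow> bool" where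
  "interval_config X m a b \<longleftrightarrow>
     (\<forall>i<m. a i < b i \<and> b i - a i \<le> X) \<and>
     (\<forall>i<m. \<forall>j<m. i \<noteq> j \<longrightarrow>
        closure (circle_interval X (a i) (b i)) \<inter> closure (circle_interval X (a j) (b j)) = {})"

definition config_set :: "real \<Rightarrow> nat \<Rightarrow> (nat \<Rightarrow> real) \<Rightarrow> (nat \<Rightarrow> real) \<Rightarrow> real set" where
  "config_set X m a b = (\<Union>i<m. circle_interval X (a i) (b i))"

definition interval_unions :: "real \<Rightarrow> nat \<Rightarrow> real set set" where
  "interval_unions X m = {config_set X m a b | a b. interval_config X m a b}"

definition equal_interval_unions :: "real \<Rightarrow> nat \<Rightarrow> real set set" where
  "equal_interval_unions X m =
     {config_set X m a b | a b. interval_config X m a b \<and>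
        (\<forall>i<m. \<forall>j<m. b i - a i = b j - a j)}"

interpretation real_fun: vector_space "\<lambda>(c::real) (f :: real \<Rightarrow> real) x. c * f x"
  by unfold_locales (auto simp: fun_eq_iff algebra_simps)

text \<open>
  Solutions of \<open>-u'' = \<lambda> u\<close> in \<open>\<Omega>\<close> with \<open>u = 0\<close> on the boundary, extended by zero to the
  whole circle; continuity of the extension expresses the boundary condition.
\<close>

definition dirichlet_eigenspace :: "real \<Rightarrow> real set \<Rightarrow> real \<Rightarrow> (real \<Rightarrow> real) set" where
  "dirichlet_eigenspace X \<Omega> \<mu> =
     {u. (\<forall>x. u (x + X) = u x) \<and> continuous_on UNIV u \<and> (\<forall>x. x \<notin> \<Omega> \<longrightarrow> u x = 0) \<and>
         (\<exists>u'. \<forall>x\<in>\<Omega>. (u has_real_derivative u' x) (at x) \<and>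
                     (u' has_real_derivative - (\<mu> * u x)) (at x))}"

definition dirichlet_spectrum :: "real \<Rightarrow> real set \<Rightarrow> real set" where
  "dirichlet_spectrum X \<Omega> = {\<mu>. \<exists>u \<in> dirichlet_eigenspace X \<Omega> \<mu>. u \<noteq> (\<lambda>_. 0)}"

definition dirichlet_multiplicity :: "real \<Rightarrow> real set \<Rightarrow> real \<Rightarrow> nat" where
  "dirichlet_multiplicity X \<Omega> \<mu> = real_fun.dim (dirichlet_eigenspace X \<Omega> \<mu>)"

text \<open>
  For a finite union of intervals the eigenspaces are finite-dimensional and only finitely
  many eigenvalues lie below any bound, so the conventions for dimensions and sums in the
  infinite case play no role.
\<close>

definition dirichlet_count :: "real \<Rightarrow> real set \<Rightarrow> real \<Rightarrow> nat" where
  "dirichlet_count X \<Omega> t =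
     (\<Sum>\<mu> \<in> {\<mu> \<in> dirichlet_spectrum X \<Omega>. \<mu> \<le> t}. dirichlet_multiplicity X \<Omega> \<mu>)"

text \<open>
  The \<open>n\<close>-th entry (\<open>n \<ge> 1\<close>) of the nondecreasing list of eigenvalues repeated according to
  multiplicity.
\<close>

definition dirichlet_eigenvalue :: "real \<Rightarrow> real set \<Rightarrow> nat \<Rightarrow> real" where
  "dirichlet_eigenvalue X \<Omega> n = Inf {t. n \<le> dirichlet_count X \<Omega> t}"

definition gap_ratio :: "real \<Rightarrow> nat \<Rightarrow> real set \<Rightarrow> real" where
  "gap_ratio X m \<Omega> =
     2 * ((dirichlet_eigenvalue X \<Omega> (m + 1) - dirichlet_eigenvalue X \<Omega> m) /
          (dirichlet_eigenvalue X \<Omega> (m + 1) + dirichlet_eigenvalue X \<Omega> m))"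

end

theory Submission
  imports Defs
begin

text \<open>
  If \<open>\<Omega>\<close> consists of \<open>m\<close> intervals of lengths \<open>l i\<close>, its eigenvalue counting function is
  \<open>N t = (\<Sum>i<m. \<lfloor>sqrt t * l i / pi\<rfloor>)\<close>, so \<open>N (4 * t) \<ge> 2 * N t\<close> and
  \<open>N t \<ge> m\<close> implies \<open>N (4 * t) \<ge> 2 * m \<ge> m + 1\<close>. Hence the \<open>(m + 1)\<close>-st eigenvalue is at most four
  times the \<open>m\<close>-th one, with equality for equal lengths, and the ratio is at most
  \<open>2 * (4 - 1) / (4 + 1)\<close>.
\<close>

section \<open>The eigenvalue equation on a single interval\<close>

text \<open>Eigenvalues are defined through dimensions of function spaces on the circle, so most of
  the work lies in proving the formula for \<open>N\<close>. This needs the eigenspace for every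
  real \<open>\<mu>\<close>: nonpositive values are excluded and positive ones solved explicitly.
  The equation is available only inside the open arcs, so all information at their ends comes from
  continuity. The eigenspace then has one basis function for each arc that has \<open>\<mu>\<close>
  among its own eigenvalues. The constant 4 is the square of 2: an interval of length l has the
  eigenvalues (n pi / l)^2, so doubling n multiplies an eigenvalue by 4. For equal lengths all terms
  of \<open>N\<close> jump together and \<open>N\<close> takes only multiples of m, which is why the
  bound is then attained. Since the eigenvalues are infima and the ratio divides by their sum, a
  positive lower bound for the spectrum is needed as well.\<close>

lemma dirichlet_solution_nonpos:
  fixes u :: "real \<Rightarrow> real"
  assumes "a < b" and cont: "continuous_on {a..b} u" and "u a = 0" "u b = 0" and "\<mu> \<le> 0"
    and du: "\<And>x. a < x \<Longrightarrow> x < b \<Longrightarrow> (u has_real_derivative u' x) (at x)"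
    and du': "\<And>x. a < x \<Longrightarrow> x < b \<Longrightarrow> (u' has_real_derivative - (\<mu> * u x)) (at x)"
    and x: "x \<in> {a..b}"
  shows "u x = 0"
proof -
  \<comment> \<open>Nothing is known about \<open>u'\<close> at the ends, so an interior critical
    point serves as the place from which signs are compared.\<close>
  have "u differentiable (at y)" if "a < y" "y < b" for y
    unfolding real_differentiable_def using du[OF that] by (rule exI)
  then obtain p where p: "a < p" "p < b" "(u has_real_derivative 0) (at p)"
    using Rolle[OF \<open>a < b\<close> _ cont] assms(3,4) by auto
  then have "u' p = 0" using DERIV_unique[OF p(3) du[OF p(1,2)]] by simp
  \<comment> \<open>The derivative of u u' is u'^2 - \<open>\<mu>\<close> u^2, which is nonnegative
    for \<open>\<mu> \<le> 0\<close>.\<close>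
  have mono: "u y * u' y \<le> u z * u' z" if "a < y" "y \<le> z" "z < b" for y z
  proof (rule DERIV_nonneg_imp_nondecreasing[OF \<open>y \<le> z\<close>])
    fix w assume "y \<le> w" "w \<le> z"
    then have w: "a < w" "w < b" using that by auto
    have "((\<lambda>x. u x * u' x) has_real_derivative u' w * u' w + - (\<mu> * u w) * u w) (at w)"
      by (rule derivative_eq_intros du[OF w] du'[OF w] refl)+
    moreover have "\<mu> * (u w * u w) \<le> 0" by (rule mult_nonpos_nonneg[OF \<open>\<mu> \<le> 0\<close> zero_le_square])
    then have "0 \<le> u' w * u' w + - (\<mu> * u w) * u w"
      using zero_le_square[of "u' w"] by (simp only: mult_minus_left mult.assoc)
    ultimately show "\<exists>d. ((\<lambda>x. u x * u' x) has_real_derivative d) (at w) \<and> 0 \<le> d" by blast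
  qed
  have dsq: "((\<lambda>x. u x * u x) has_real_derivative 2 * (u w * u' w)) (at w)" if "a < w" "w < b" for w
    by (rule derivative_eq_intros du[OF that] refl)+ simp
  have csq: "continuous_on S (\<lambda>x. u x * u x)" if "S \<subseteq> {a..b}" for S
    using continuous_on_subset[OF cont that] by (intro continuous_intros)
  \<comment> \<open>As u u' vanishes at \<open>p\<close>, it is nonpositive before \<open>p\<close>
    and nonnegative after. So u^2 decreases up to \<open>p\<close> and increases from there, and its
    zero value at the nearer side's endpoint bounds it from above.\<close>
  have "u x * u x \<le> 0"
  proof (cases "x \<le> p")
    case True
    have "u a * u a \<ge> u x * u x"
    proof (rule DERIV_nonpos_imp_decreasing_open[of a x "\<lambda>x. u x * u x"])
      fix w assume "a < w" "w < x"
      then have w: "a < w" "w < b" "w \<le> p" using p True by auto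
      then have "2 * (u w * u' w) \<le> 0" using mono[of w p] p \<open>u' p = 0\<close> by simp
      then show "\<exists>d. ((\<lambda>x. u x * u x) has_real_derivative d) (at w) \<and> d \<le> 0"
        using dsq[OF w(1,2)] by (intro exI conjI)
    qed (use x csq[of "{a..x}"] in simp_all)
    then show ?thesis using \<open>u a = 0\<close> by simp
  next
    case False
    have "u x * u x \<le> u b * u b"
    proof (rule DERIV_nonneg_imp_increasing_open[of x b "\<lambda>x. u x * u x"])
      fix w assume "x < w" "w < b"
      then have w: "a < w" "w < b" "p \<le> w" using p False by auto
      then have "0 \<le> 2 * (u w * u' w)" using mono[of p w] p \<open>u' p = 0\<close> by simp
      then show "\<exists>d. ((\<lambda>x. u x * u x) has_real_derivative d) (at w) \<and> d \<ge> 0"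
        using dsq[OF w(1,2)] by (intro exI conjI)
    qed (use x csq[of "{x..b}"] in simp_all)
    then show ?thesis using \<open>u b = 0\<close> by simp
  qed
  then show ?thesis by (auto simp: mult_le_0_iff)
qed

text \<open>Two constant Wronskians take the place of a uniqueness theorem for the equation: solving
  the two linear relations for u by means of sin^2 + cos^2 = 1 gives u inside, continuity extends
  this to the ends, and \<open>u a = 0\<close> removes the cosine. The condition at the other end
  enters in \<open>dirichlet_solution\<close>, where it restricts \<open>\<mu>\<close>.\<close>

lemma dirichlet_solution_pos:
  fixes u :: "real \<Rightarrow> real"
  assumes "a < b" and cont: "continuous_on {a..b} u" and "u a = 0" and "\<mu> > 0"
    and du: "\<And>x. a < x \<Longrightarrow> x < b \<Longrightarrow> (u has_real_derivative u' x) (at x)"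
    and du': "\<And>x. a < x \<Longrightarrow> x < b \<Longrightarrow> (u' has_real_derivative - (\<mu> * u x)) (at x)"
  shows "\<exists>c. \<forall>x\<in>{a..b}. u x = c * sin (sqrt \<mu> * (x - a))"
proof -
  define \<omega> where "\<omega> = sqrt \<mu>"
  have \<omega>: "\<omega> > 0" "\<omega> * \<omega> = \<mu>" using \<open>\<mu> > 0\<close> by (auto simp: \<omega>_def)
  define s where "s x = sin (\<omega> * (x - a))" for x
  define c where "c x = cos (\<omega> * (x - a))" for x
  have ds: "(s has_real_derivative \<omega> * c x) (at x)" for x
    unfolding s_def c_def by (auto intro!: derivative_eq_intros)
  have dc: "(c has_real_derivative - (\<omega> * s x)) (at x)" for x
    unfolding s_def c_def by (auto intro!: derivative_eq_intros)
  \<comment> \<open>The Wronskians of \<open>u\<close> with the two standard solutions are constant.\<close>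
  have W1: "((\<lambda>x. u' x * s x - u x * (\<omega> * c x)) has_real_derivative 0) (at x)"
    if "a < x" "x < b" for x
    by (rule derivative_eq_intros du[OF that] du'[OF that] ds dc refl)+
       (simp add: algebra_simps flip: \<omega>(2))
  have W2: "((\<lambda>x. u' x * c x + u x * (\<omega> * s x)) has_real_derivative 0) (at x)"
    if "a < x" "x < b" for x
    by (rule derivative_eq_intros du[OF that] du'[OF that] ds dc refl)+
       (simp add: algebra_simps flip: \<omega>(2))
  obtain A where A: "\<And>x. x \<in> {a<..<b} \<Longrightarrow> u' x * s x - u x * (\<omega> * c x) = A"
    using has_field_derivative_zero_constant[of "{a<..<b}", OF _ has_field_derivative_at_within[OF W1]]
    by (auto simp: convex_real_interval)
  obtain B where B: "\<And>x. x \<in> {a<..<b} \<Longrightarrow> u' x * c x + u x * (\<omega> * s x) = B"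
    using has_field_derivative_zero_constant[of "{a<..<b}", OF _ has_field_derivative_at_within[OF W2]]
    by (auto simp: convex_real_interval)
  have inside: "\<omega> * u x - (B * s x - A * c x) = 0" if "x \<in> {a<..<b}" for x
  proof -
    have "B * s x - A * c x = \<omega> * u x * ((s x)\<^sup>2 + (c x)\<^sup>2)"
      unfolding A[OF that, symmetric] B[OF that, symmetric]
      by (simp add: algebra_simps power2_eq_square)
    then show ?thesis by (simp add: s_def c_def)
  qed
  have "continuous_on {a..b} (\<lambda>x. \<omega> * u x - (B * s x - A * c x))"
    unfolding s_def c_def by (intro continuous_intros cont)
  then have sol: "\<omega> * u x - (B * s x - A * c x) = 0" if "x \<in> {a..b}" for x
    using continuous_constant_on_closure[of "{a<..<b}" "\<lambda>x. \<omega> * u x - (B * s x - A * c x)" 0 x]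
      inside that \<open>a < b\<close> by simp
  have "A = 0" using sol[of a] \<open>a < b\<close> \<open>u a = 0\<close> by (simp add: s_def c_def)
  then have "u x = B / \<omega> * sin (sqrt \<mu> * (x - a))" if "x \<in> {a..b}" for x
    using sol[OF that] \<omega>(1) by (simp add: s_def \<omega>_def field_simps)
  then show ?thesis by blast
qed

text \<open>These are the numbers (n pi / l)^2 with n >= 1, written in the form in which the
  boundary condition at the second endpoint produces them.\<close>

definition interval_dirichlet_spectrum :: "real \<Rightarrow> real set" where
  "interval_dirichlet_spectrum l = {\<mu>. \<mu> > 0 \<and> sin (sqrt \<mu> * l) = 0}"

text \<open>The coefficient is forced to 0 off the spectrum so that one formula covers all real
  \<open>\<mu>\<close>, also the nonpositive ones, where the sine term does not solve the equation
  in general.\<close>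

lemma dirichlet_solution:
  fixes u :: "real \<Rightarrow> real"
  assumes "a < b" and "continuous_on {a..b} u" and "u a = 0" "u b = 0"
    and "\<And>x. a < x \<Longrightarrow> x < b \<Longrightarrow> (u has_real_derivative u' x) (at x)"
    and "\<And>x. a < x \<Longrightarrow> x < b \<Longrightarrow> (u' has_real_derivative - (\<mu> * u x)) (at x)"
  shows "\<exists>c. (\<mu> \<notin> interval_dirichlet_spectrum (b - a) \<longrightarrow> c = 0) \<and>
    (\<forall>x\<in>{a..b}. u x = c * sin (sqrt \<mu> * (x - a)))"
proof (cases "\<mu> > 0")
  case True
  then obtain c where c: "\<forall>x\<in>{a..b}. u x = c * sin (sqrt \<mu> * (x - a))"
    using dirichlet_solution_pos[OF assms(1,2,3) True assms(5,6)] by blast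
  then have "c * sin (sqrt \<mu> * (b - a)) = 0" using assms(1,4) by auto
  then show ?thesis using c True by (auto simp: interval_dirichlet_spectrum_def)
next
  case False
  then show ?thesis using dirichlet_solution_nonpos[OF assms(1-4) _ assms(5,6)] by (intro exI[of _ 0]) auto
qed

lemma nat_floor_ge_iff:
  assumes "n \<ge> 1"
  shows "n \<le> nat \<lfloor>y\<rfloor> \<longleftrightarrow> real n \<le> y"
proof -
  have "n \<le> nat \<lfloor>y\<rfloor> \<longleftrightarrow> int n \<le> \<lfloor>y\<rfloor>" using assms by linarith
  then show ?thesis by (simp add: le_floor_iff)
qed

text \<open>Any real \<open>t\<close> is allowed: \<open>sqrt\<close> is odd and strictly increasing
  on all reals, so for negative \<open>t\<close> the floor is negative, \<open>nat\<close> turns it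
  into 0, and both sides are empty.\<close>

lemma interval_dirichlet_spectrum_atMost:
  assumes "l > 0"
  shows "interval_dirichlet_spectrum l \<inter> {..t} =
    (\<lambda>n. (real n * pi / l)\<^sup>2) ` {1..nat \<lfloor>sqrt t * l / pi\<rfloor>}"
proof -
  have le: "(real n * pi / l)\<^sup>2 \<le> t \<longleftrightarrow> n \<le> nat \<lfloor>sqrt t * l / pi\<rfloor>" if "n \<ge> 1" for n
  proof -
    have "(real n * pi / l)\<^sup>2 \<le> t \<longleftrightarrow> real n * pi / l \<le> sqrt t"
      by (metis abs_of_nonneg assms divide_nonneg_pos mult_nonneg_nonneg of_nat_0_le_iff pi_ge_zero
          real_sqrt_abs real_sqrt_le_iff)
    also have "\<dots> \<longleftrightarrow> real n \<le> sqrt t * l / pi" using assms by (simp add: field_simps)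
    also have "\<dots> \<longleftrightarrow> n \<le> nat \<lfloor>sqrt t * l / pi\<rfloor>" by (simp only: nat_floor_ge_iff[OF that])
    finally show ?thesis .
  qed
  have spec: "\<mu> \<in> interval_dirichlet_spectrum l \<longleftrightarrow> (\<exists>n\<ge>1. \<mu> = (real n * pi / l)\<^sup>2)" for \<mu>
  proof
    assume "\<mu> \<in> interval_dirichlet_spectrum l"
    then have \<mu>: "\<mu> > 0" "sin (sqrt \<mu> * l) = 0" by (auto simp: interval_dirichlet_spectrum_def)
    then obtain i :: int where i: "sqrt \<mu> * l = of_int i * pi" using sin_zero_iff_int2 by blast
    have "sqrt \<mu> * l > 0" using \<mu> assms by simp
    then have "i > 0" unfolding i by (simp add: zero_less_mult_iff)
    moreover have "sqrt \<mu> = of_int i * pi / l" using i assms by (simp add: field_simps)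
    then have "\<mu> = (of_int i * pi / l)\<^sup>2" using \<mu> by (metis less_imp_le real_sqrt_pow2)
    ultimately show "\<exists>n\<ge>1. \<mu> = (real n * pi / l)\<^sup>2" by (intro exI[of _ "nat i"]) auto
  next
    assume "\<exists>n\<ge>1. \<mu> = (real n * pi / l)\<^sup>2"
    then obtain n where "n \<ge> 1" "\<mu> = (real n * pi / l)\<^sup>2" by blast
    then show "\<mu> \<in> interval_dirichlet_spectrum l"
      using assms by (simp add: interval_dirichlet_spectrum_def)
  qed
  have "interval_dirichlet_spectrum l \<inter> {..t} =
      (\<lambda>n. (real n * pi / l)\<^sup>2) ` {n. n \<ge> 1 \<and> (real n * pi / l)\<^sup>2 \<le> t}"
    by (rule set_eqI) (auto simp only: Int_iff atMost_iff spec image_iff mem_Collect_eq bex_simps)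
  also have "{n. n \<ge> 1 \<and> (real n * pi / l)\<^sup>2 \<le> t} = {1..nat \<lfloor>sqrt t * l / pi\<rfloor>}" using le by auto
  finally show ?thesis .
qed

lemma finite_interval_dirichlet_spectrum_atMost:
  "l > 0 \<Longrightarrow> finite (interval_dirichlet_spectrum l \<inter> {..t})"
  by (simp add: interval_dirichlet_spectrum_atMost)

lemma card_interval_dirichlet_spectrum_atMost:
  assumes "l > 0"
  shows "card (interval_dirichlet_spectrum l \<inter> {..t}) = nat \<lfloor>sqrt t * l / pi\<rfloor>"
proof -
  have "inj_on (\<lambda>n. (real n * pi / l)\<^sup>2) A" for A
    using assms by (auto intro!: inj_onI simp: power2_eq_iff_nonneg)
  then show ?thesis by (simp add: interval_dirichlet_spectrum_atMost[OF assms] card_image)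
qed

section \<open>Eigenfunctions supported on one arc of the circle\<close>

lemma open_circle_interval: "open (circle_interval X a b)"
  by (auto simp: circle_interval_def)

lemma not_in_circle_interval:
  "x \<notin> circle_interval X a b \<Longrightarrow> x \<le> a + of_int k * X \<or> x \<ge> b + of_int k * X"
  unfolding circle_interval_def by (simp add: not_less)

lemma circle_interval_shift: "x + of_int k * X \<in> circle_interval X a b \<longleftrightarrow> x \<in> circle_interval X a b"
proof -
  have "x + of_int k * X \<in> circle_interval X a b" if x: "x \<in> circle_interval X a b" for x k
  proof -
    obtain j where "a + of_int j * X < x" "x < b + of_int j * X"
      using x by (auto simp: circle_interval_def)
    then show ?thesis
      by (auto simp: circle_interval_def algebra_simps intro!: exI[of _ "j + k"])
  qed
  from this[of x k] this[of "x + of_int k * X" "- k"] show ?thesis by auto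
qed

lemma Icc_subset_closure_circle_interval:
  assumes "a < b"
  shows "{a..b} \<subseteq> closure (circle_interval X a b)"
proof -
  have "{a<..<b} \<subseteq> circle_interval X a b"
    unfolding circle_interval_def by (rule subset_trans[OF _ UN_upper[of 0]]) auto
  from closure_mono[OF this] show ?thesis using assms by simp
qed

text \<open>As \<open>b - a \<le> X\<close>, the translates to the right begin no earlier than
  \<open>b\<close> and those to the left end no later than \<open>a\<close>. This covers the circle
  with one point removed, where neighbouring translates share an endpoint.\<close>

lemma endpoint_notin_circle_interval:
  assumes "X > 0" "b - a \<le> X"
  shows "a \<notin> circle_interval X a b" "b \<notin> circle_interval X a b"
proof -
  have False if k: "a + of_int k * X < z" "z < b + of_int k * X" and "z = a \<or> z = b" for z k
  proof -
    consider "k \<ge> 1" | "k = 0" | "k \<le> -1" by linarith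
    then show False
    proof cases
      case 1
      then have "1 * X \<le> of_int k * X" using assms(1) by (intro mult_right_mono) auto
      then show False using that assms by linarith
    next
      case 2
      then show False using that by simp
    next
      case 3
      then have "of_int k * X \<le> -1 * X" using assms(1) by (intro mult_right_mono) auto
      then show False using that assms by linarith
    qed
  qed
  then show "a \<notin> circle_interval X a b" "b \<notin> circle_interval X a b"
    unfolding circle_interval_def greaterThanLessThan_iff UN_iff by blast+
qed

text \<open>The floor finds the translate that contains \<open>x\<close>, and \<open>\<phi>\<close>
  is evaluated at the distance from the left end of that translate. The profile need not vanish at 0
  or \<open>b - a\<close>, so the same construction also describes the derivatives of an
  eigenfunction.\<close>

definition periodic_piece :: "real \<Rightarrow> real \<Rightarrow> real \<Rightarrow> (real \<Rightarrow> real) \<Rightarrow> real \<Rightarrow> real" where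
  "periodic_piece X a b \<phi> x =
     (if x \<in> circle_interval X a b then \<phi> (x - X * of_int \<lfloor>(x - a) / X\<rfloor> - a) else 0)"

lemma periodic_piece_outside: "x \<notin> circle_interval X a b \<Longrightarrow> periodic_piece X a b \<phi> x = 0"
  by (simp add: periodic_piece_def)

lemma floor_circle_interval:
  assumes "X > 0" "b - a \<le> X" "a + of_int k * X < x" "x < b + of_int k * X"
  shows "\<lfloor>(x - a) / X\<rfloor> = k"
  using assms by (auto simp: floor_eq_iff field_simps)

lemma periodic_piece_eq:
  assumes "X > 0" "b - a \<le> X" "a + of_int k * X < x" "x < b + of_int k * X"
  shows "periodic_piece X a b \<phi> x = \<phi> (x - of_int k * X - a)"
  using floor_circle_interval[OF assms] assms
  by (auto simp: periodic_piece_def circle_interval_def mult.commute)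

lemma periodic_piece_periodic:
  assumes "X > 0"
  shows "periodic_piece X a b \<phi> (x + X) = periodic_piece X a b \<phi> x"
proof -
  have "(x + X - a) / X = (x - a) / X + 1" using assms by (simp add: field_simps)
  then show ?thesis
    using circle_interval_shift[of x 1 X a b] by (simp add: periodic_piece_def algebra_simps)
qed

lemma continuous_periodic_piece:
  assumes X: "X > 0" "b - a \<le> X" and "a < b"
    and \<phi>: "continuous_on UNIV \<phi>" "\<phi> 0 = 0" "\<phi> (b - a) = 0"
  shows "continuous_on UNIV (periodic_piece X a b \<phi>)"
proof -
  \<comment> \<open>Clamping the argument to the interval makes one bump continuous on the whole
    line, since \<open>\<phi>\<close> vanishes at both ends.\<close>
  define g where "g z = \<phi> (max 0 (min (b - a) (z - a)))" for z
  have g_cont: "continuous_on UNIV (\<lambda>x. g (x - d))" for d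
    unfolding g_def
    by (rule continuous_on_compose2[OF \<phi>(1)]) (auto intro!: continuous_intros)
  have g_in: "g z = \<phi> (z - a)" if "a \<le> z" "z \<le> b" for z
    using that by (auto simp: g_def max_def min_def)
  have g_out: "g z = 0" if "z \<le> a \<or> z \<ge> b" for z
    using that \<phi> \<open>a < b\<close> by (auto simp: g_def max_def min_def)
  have "isCont (periodic_piece X a b \<phi>) x0" for x0
  proof -
    define k where "k = \<lfloor>(x0 - a) / X\<rfloor>"
    \<comment> \<open>The point \<open>x0\<close> may be the left end of translate \<open>k\<close>,
      so the window reaches back over translate \<open>k - 1\<close>. No other translate meets it,
      and there the piece is the sum of two clamped bumps, at most one of them nonzero.\<close>
    define U where "U = {a + of_int (k - 1) * X <..< a + of_int (k + 1) * X}"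
    have "of_int k \<le> (x0 - a) / X" "(x0 - a) / X < of_int k + 1" unfolding k_def by linarith+
    then have "x0 \<in> U" using X by (auto simp: U_def field_simps)
    have eq: "g (x - of_int (k - 1) * X) + g (x - of_int k * X) = periodic_piece X a b \<phi> x"
      if "x \<in> U" for x
    proof (cases "x \<in> circle_interval X a b")
      case True
      then obtain j where j: "a + of_int j * X < x" "x < b + of_int j * X"
        by (auto simp: circle_interval_def)
      have "a + of_int (k - 1) * X < a + of_int (j + 1) * X"
        using that j X(2) by (simp add: U_def algebra_simps)
      then have "k - 1 < j + 1" using X(1) by (simp only: add_less_cancel_left mult_less_cancel_right_pos of_int_less_iff)
      moreover have "a + of_int j * X < a + of_int (k + 1) * X"
        using that j by (simp add: U_def)
      then have "j < k + 1" using X(1) by (simp only: add_less_cancel_left mult_less_cancel_right_pos of_int_less_iff)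
      ultimately have "j = k - 1 \<or> j = k" by linarith
      then show ?thesis
      proof
        assume jk: "j = k - 1"
        have "g (x - of_int k * X) = 0" using j X(2) by (intro g_out) (auto simp: jk algebra_simps)
        moreover have "g (x - of_int j * X) = \<phi> (x - of_int j * X - a)" using j by (intro g_in) auto
        ultimately show ?thesis using periodic_piece_eq[OF X j] jk by simp
      next
        assume jk: "j = k"
        have "g (x - of_int (k - 1) * X) = 0"
          using j X(2) by (intro g_out) (auto simp: jk algebra_simps)
        moreover have "g (x - of_int j * X) = \<phi> (x - of_int j * X - a)" using j by (intro g_in) auto
        ultimately show ?thesis using periodic_piece_eq[OF X j] jk by simp
      qed
    next
      case False
      then have "g (x - of_int j * X) = 0" for j
        using not_in_circle_interval[of x X a b j] by (intro g_out) auto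
      from this[of "k - 1"] this[of k] show ?thesis using False by (simp add: periodic_piece_outside)
    qed
    have "continuous_on U (\<lambda>x. g (x - of_int (k - 1) * X) + g (x - of_int k * X))"
      by (intro continuous_on_add continuous_on_subset[OF g_cont] subset_UNIV)
    then have "continuous_on U (periodic_piece X a b \<phi>)"
      by (rule continuous_on_eq) (use eq in blast)
    moreover have "open U" by (simp add: U_def)
    ultimately show ?thesis using \<open>x0 \<in> U\<close> continuous_on_eq_continuous_at by blast
  qed
  then show ?thesis by (simp add: continuous_on_eq_continuous_at)
qed

text \<open>The set \<open>S\<close> stands for the other arcs, where the piece is locally zero. The
  derivative is again a periodic piece, so a second application yields the second
  derivative.\<close>

lemma periodic_piece_has_derivative:
  assumes X: "X > 0" "b - a \<le> X"
    and \<phi>: "\<And>x. (\<phi> has_real_derivative \<phi>' x) (at x)"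
    and S: "open S" "S \<inter> circle_interval X a b = {}" and x: "x \<in> circle_interval X a b \<union> S"
  shows "(periodic_piece X a b \<phi> has_real_derivative periodic_piece X a b \<phi>' x) (at x)"
proof (cases "x \<in> S")
  case True
  have "((\<lambda>_. 0) has_real_derivative periodic_piece X a b \<phi>' x) (at x)"
    using True S by (auto simp: periodic_piece_outside disjoint_iff)
  then show ?thesis
    by (rule has_field_derivative_transform_within_open[OF _ S(1) True])
       (use S in \<open>auto simp: periodic_piece_outside disjoint_iff\<close>)
next
  case False
  then obtain k where k: "a + of_int k * X < x" "x < b + of_int k * X"
    using x by (auto simp: circle_interval_def)
  have "((\<lambda>x. \<phi> (x - of_int k * X - a)) has_real_derivative \<phi>' (x - of_int k * X - a) * 1) (at x)"
    by (rule DERIV_chain2[OF \<phi>]) (auto intro!: derivative_eq_intros)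
  then have "((\<lambda>x. \<phi> (x - of_int k * X - a)) has_real_derivative periodic_piece X a b \<phi>' x) (at x)"
    using periodic_piece_eq[OF X k] by simp
  then show ?thesis
    by (rule has_field_derivative_transform_within_open[of _ _ _ "{a + of_int k * X <..< b + of_int k * X}"])
       (use k periodic_piece_eq[OF X] in auto)
qed

section \<open>Multiplicities and the counting function\<close>

lemma interval_configD:
  assumes "interval_config X m a b" "i < m"
  shows "a i < b i" "b i - a i \<le> X"
  using assms by (auto simp: interval_config_def)

lemma interval_config_disjoint_closure:
  assumes "interval_config X m a b" "i < m" "j < m" "i \<noteq> j"
  shows "closure (circle_interval X (a i) (b i)) \<inter> closure (circle_interval X (a j) (b j)) = {}"
  using assms by (auto simp: interval_config_def)

lemma interval_config_disjoint:
  assumes "interval_config X m a b" "i < m" "j < m" "i \<noteq> j" "x \<in> circle_interval X (a i) (b i)"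
  shows "x \<notin> circle_interval X (a j) (b j)"
  using interval_config_disjoint_closure[OF assms(1-4)] assms(5) closure_subset by blast

text \<open>This turns the vanishing of eigenfunctions outside the set into Dirichlet conditions at
  both ends of every arc, so that each arc can be treated alone.\<close>

lemma endpoint_notin_config_set:
  assumes "X > 0" and cfg: "interval_config X m a b" and i: "i < m"
  shows "a i \<notin> config_set X m a b" "b i \<notin> config_set X m a b"
proof -
  have "z \<notin> config_set X m a b" if z: "z \<in> {a i..b i}" "z \<notin> circle_interval X (a i) (b i)" for z
  proof
    assume "z \<in> config_set X m a b"
    then obtain j where j: "j < m" "z \<in> circle_interval X (a j) (b j)" by (auto simp: config_set_def)
    then have "j \<noteq> i" using z by blast
    moreover have "z \<in> closure (circle_interval X (a i) (b i))"
      using Icc_subset_closure_circle_interval[OF interval_configD(1)[OF cfg i]] z by blast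
    ultimately show False
      using interval_config_disjoint_closure[OF cfg i j(1)] j(2) closure_subset by blast
  qed
  then show "a i \<notin> config_set X m a b" "b i \<notin> config_set X m a b"
    using endpoint_notin_circle_interval[OF \<open>X > 0\<close> interval_configD(2)[OF cfg i]]
      interval_configD(1)[OF cfg i] by auto
qed

abbreviation arc_mode :: "real \<Rightarrow> (nat \<Rightarrow> real) \<Rightarrow> (nat \<Rightarrow> real) \<Rightarrow> real \<Rightarrow> nat \<Rightarrow> real \<Rightarrow> real" where
  "arc_mode X a b \<mu> i \<equiv> periodic_piece X (a i) (b i) (\<lambda>z. sin (sqrt \<mu> * z))"

text \<open>The arcs that contribute to the eigenspace of \<open>\<mu>\<close>; their number turns
  out to be the multiplicity.\<close>

definition resonant_arcs :: "nat \<Rightarrow> (nat \<Rightarrow> real) \<Rightarrow> (nat \<Rightarrow> real) \<Rightarrow> real \<Rightarrow> nat set" where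
  "resonant_arcs m a b \<mu> = {i. i < m \<and> \<mu> \<in> interval_dirichlet_spectrum (b i - a i)}"

lemma finite_resonant_arcs [simp]: "finite (resonant_arcs m a b \<mu>)"
  by (simp add: resonant_arcs_def)

lemma arc_mode_in_eigenspace:
  assumes "X > 0" and cfg: "interval_config X m a b" and i: "i \<in> resonant_arcs m a b \<mu>"
  shows "arc_mode X a b \<mu> i \<in> dirichlet_eigenspace X (config_set X m a b) \<mu>"
proof -
  have im: "i < m" and \<mu>: "\<mu> > 0" "sin (sqrt \<mu> * (b i - a i)) = 0"
    using i by (auto simp: resonant_arcs_def interval_dirichlet_spectrum_def)
  note ab = interval_configD[OF cfg im]
  define S where "S = (\<Union>j\<in>{..<m} - {i}. circle_interval X (a j) (b j))"
  have S: "open S" "S \<inter> circle_interval X (a i) (b i) = {}"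
    using interval_config_disjoint[OF cfg _ im] by (auto simp: S_def open_circle_interval)
  have \<Omega>: "config_set X m a b = circle_interval X (a i) (b i) \<union> S"
    using im by (auto simp: config_set_def S_def)
  let ?C = "\<lambda>z. sqrt \<mu> * cos (sqrt \<mu> * z)" and ?S = "\<lambda>z. - (\<mu> * sin (sqrt \<mu> * z))"
  have "(arc_mode X a b \<mu> i has_real_derivative periodic_piece X (a i) (b i) ?C x) (at x)"
    if "x \<in> config_set X m a b" for x
    by (rule periodic_piece_has_derivative[OF \<open>X > 0\<close> ab(2) _ S])
       (use that in \<open>auto simp: \<Omega> intro!: derivative_eq_intros\<close>)
  moreover have "(periodic_piece X (a i) (b i) ?C has_real_derivative periodic_piece X (a i) (b i) ?S x) (at x)"
    if "x \<in> config_set X m a b" for x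
  proof (rule periodic_piece_has_derivative[OF \<open>X > 0\<close> ab(2) _ S])
    fix z show "(?C has_real_derivative ?S z) (at z)"
      using \<mu> by (auto intro!: derivative_eq_intros)
  qed (use that in \<open>simp add: \<Omega>\<close>)
  moreover have "periodic_piece X (a i) (b i) ?S x = - (\<mu> * arc_mode X a b \<mu> i x)" for x
    by (simp add: periodic_piece_def)
  moreover have "continuous_on UNIV (arc_mode X a b \<mu> i)"
    using \<mu> by (intro continuous_periodic_piece \<open>X > 0\<close> ab) (auto intro!: continuous_intros)
  ultimately show ?thesis
    unfolding dirichlet_eigenspace_def
    by (auto simp: periodic_piece_periodic[OF \<open>X > 0\<close>] \<Omega> periodic_piece_outside
        intro!: exI[of _ "periodic_piece X (a i) (b i) ?C"])
qed

text \<open>The peak lies a quarter wave, pi / (2 sqrt \<open>\<mu>\<close>), after the left end. It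
  is inside the arc because a positive zero of the sine is at least pi. Evaluation there separates
  the modes, which gives injectivity, independence and nonvanishing.\<close>

lemma arc_mode_peak:
  assumes "X > 0" and cfg: "interval_config X m a b" and i: "i \<in> resonant_arcs m a b \<mu>"
  obtains x where "arc_mode X a b \<mu> i x = 1" "\<And>j. j < m \<Longrightarrow> j \<noteq> i \<Longrightarrow> arc_mode X a b \<mu> j x = 0"
proof -
  have im: "i < m" and \<mu>: "\<mu> > 0" "sin (sqrt \<mu> * (b i - a i)) = 0"
    using i by (auto simp: resonant_arcs_def interval_dirichlet_spectrum_def)
  note ab = interval_configD[OF cfg im]
  have "pi \<le> sqrt \<mu> * (b i - a i)"
    using sin_gt_zero[of "sqrt \<mu> * (b i - a i)"] \<mu> ab by fastforce
  then have "pi / 2 < (b i - a i) * sqrt \<mu>" using pi_gt_zero by (simp only: mult.commute)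
  then have lt: "pi / 2 / sqrt \<mu> < b i - a i" using \<mu> by (simp only: pos_divide_less_eq real_sqrt_gt_zero)
  define x where "x = a i + pi / 2 / sqrt \<mu>"
  have x: "a i + of_int 0 * X < x" "x < b i + of_int 0 * X" using lt \<mu> by (auto simp: x_def)
  have "arc_mode X a b \<mu> i x = 1"
    using periodic_piece_eq[OF \<open>X > 0\<close> ab(2) x] \<mu> by (simp add: x_def)
  moreover have "x \<in> circle_interval X (a i) (b i)"
    unfolding circle_interval_def using x by (intro UN_I[of 0]) auto
  then have "arc_mode X a b \<mu> j x = 0" if "j < m" "j \<noteq> i" for j
    using interval_config_disjoint[OF cfg im that(1)] that(2) by (auto simp: periodic_piece_outside)
  ultimately show ?thesis by (rule that)
qed

lemma inj_arc_mode:
  assumes "X > 0" "interval_config X m a b"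
  shows "inj_on (arc_mode X a b \<mu>) (resonant_arcs m a b \<mu>)"
proof (rule inj_onI, rule ccontr)
  fix i j assume ij: "i \<in> resonant_arcs m a b \<mu>" "j \<in> resonant_arcs m a b \<mu>"
    "arc_mode X a b \<mu> i = arc_mode X a b \<mu> j" "i \<noteq> j"
  obtain x where x: "arc_mode X a b \<mu> i x = 1" "\<And>j. j < m \<Longrightarrow> j \<noteq> i \<Longrightarrow> arc_mode X a b \<mu> j x = 0"
    using arc_mode_peak[OF assms ij(1)] by metis
  have "arc_mode X a b \<mu> j x = 0" using x(2)[of j] ij(2,4) by (auto simp: resonant_arcs_def)
  then show False using x(1) fun_cong[OF ij(3), of x] by linarith
qed

text \<open>Linear combinations in the vector space are sums of functions; this lets them be
  evaluated at a point.\<close>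

lemma sum_fun_scaled_apply:
  fixes g :: "'a \<Rightarrow> real \<Rightarrow> real"
  shows "(\<Sum>i\<in>A. (\<lambda>x. c i * g i x)) x = (\<Sum>i\<in>A. c i * g i x)"
  by (induction A rule: infinite_finite_induct) auto

lemma independent_arc_modes:
  assumes "X > 0" "interval_config X m a b"
  shows "\<not> real_fun.dependent (arc_mode X a b \<mu> ` resonant_arcs m a b \<mu>)"
proof
  let ?I = "resonant_arcs m a b \<mu>"
  assume "real_fun.dependent (arc_mode X a b \<mu> ` ?I)"
  then obtain c where nz: "\<exists>v\<in>arc_mode X a b \<mu> ` ?I. c v \<noteq> 0"
    and sum0: "(\<Sum>v\<in>arc_mode X a b \<mu> ` ?I. (\<lambda>x. c v * v x)) = 0"
    unfolding real_fun.dependent_finite[OF finite_imageI[OF finite_resonant_arcs]] by (elim exE conjE)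
  from nz obtain v where v: "v \<in> arc_mode X a b \<mu> ` ?I" "c v \<noteq> 0" by (elim bexE)
  from v(1) obtain i where i: "i \<in> ?I" "v = arc_mode X a b \<mu> i" by (elim imageE)
  obtain x where x: "arc_mode X a b \<mu> i x = 1" "\<And>j. j < m \<Longrightarrow> j \<noteq> i \<Longrightarrow> arc_mode X a b \<mu> j x = 0"
    using arc_mode_peak[OF assms i(1)] by metis
  have "0 = (\<Sum>j\<in>?I. (\<lambda>x. c (arc_mode X a b \<mu> j) * arc_mode X a b \<mu> j x)) x"
    using sum0 by (simp add: sum.reindex[OF inj_arc_mode[OF assms]] o_def)
  also have "\<dots> = (\<Sum>j\<in>?I. c (arc_mode X a b \<mu> j) * arc_mode X a b \<mu> j x)"
    by (rule sum_fun_scaled_apply)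
  also have "\<dots> = (\<Sum>j\<in>?I. if j = i then c v else 0)"
    by (rule sum.cong) (use x i in \<open>auto simp: resonant_arcs_def\<close>)
  also have "\<dots> = c v" using i by simp
  finally show False using v(2) by simp
qed

lemma eigenspace_subset_span_arc_modes:
  assumes "X > 0" and cfg: "interval_config X m a b"
  shows "dirichlet_eigenspace X (config_set X m a b) \<mu> \<subseteq>
    real_fun.span (arc_mode X a b \<mu> ` resonant_arcs m a b \<mu>)"
proof
  let ?I = "resonant_arcs m a b \<mu>" and ?\<Omega> = "config_set X m a b"
  fix u assume "u \<in> dirichlet_eigenspace X ?\<Omega> \<mu>"
  then obtain u' where per: "\<And>x. u (x + X) = u x" and cont: "continuous_on UNIV u"
    and out: "\<And>x. x \<notin> ?\<Omega> \<Longrightarrow> u x = 0"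
    and du: "\<And>x. x \<in> ?\<Omega> \<Longrightarrow> (u has_real_derivative u' x) (at x)"
    and du': "\<And>x. x \<in> ?\<Omega> \<Longrightarrow> (u' has_real_derivative - (\<mu> * u x)) (at x)"
    unfolding dirichlet_eigenspace_def by blast
  have "\<exists>c. (\<mu> \<notin> interval_dirichlet_spectrum (b i - a i) \<longrightarrow> c = 0) \<and>
      (\<forall>x\<in>{a i..b i}. u x = c * sin (sqrt \<mu> * (x - a i)))" if i: "i < m" for i
  proof (rule dirichlet_solution[OF interval_configD(1)[OF cfg i]])
    have in\<Omega>: "x \<in> ?\<Omega>" if "a i < x" "x < b i" for x
      using that i unfolding config_set_def circle_interval_def
      by (intro UN_I[of i] UN_I[of 0]) auto
    show "continuous_on {a i..b i} u" using cont continuous_on_subset by blast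
    show "u (a i) = 0" "u (b i) = 0"
      using out endpoint_notin_config_set[OF \<open>X > 0\<close> cfg i] by auto
    show "(u has_real_derivative u' x) (at x)" "(u' has_real_derivative - (\<mu> * u x)) (at x)"
      if "a i < x" "x < b i" for x using du du' in\<Omega> that by auto
  qed
  then obtain c where c0: "\<And>i. i < m \<Longrightarrow> i \<notin> ?I \<Longrightarrow> c i = 0"
    and c: "\<And>i x. i < m \<Longrightarrow> x \<in> {a i..b i} \<Longrightarrow> u x = c i * sin (sqrt \<mu> * (x - a i))"
    unfolding resonant_arcs_def by (simp only: mem_Collect_eq) metis
  have per_nat: "u (x + of_nat n * X) = u x" for x n
  proof (induction n)
    case (Suc n)
    have "u (x + of_nat (Suc n) * X) = u ((x + of_nat n * X) + X)" by (simp add: algebra_simps)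
    then show ?case using per Suc by simp
  qed simp
  \<comment> \<open>For negative \<open>k\<close> the case of natural multiples is applied at the
    shifted point, going back to \<open>x\<close>.\<close>
  have per_int: "u (x + of_int k * X) = u x" for x k
    using per_nat[of x "nat k"] per_nat[of "x + of_int k * X" "nat (- k)"] by (cases "k \<ge> 0") auto
  have "u = (\<Sum>i\<in>?I. (\<lambda>x. c i * arc_mode X a b \<mu> i x))"
  proof
    fix x
    show "u x = (\<Sum>i\<in>?I. (\<lambda>x. c i * arc_mode X a b \<mu> i x)) x"
    proof (cases "x \<in> ?\<Omega>")
      case True
      then obtain i k where i: "i < m" and k: "a i + of_int k * X < x" "x < b i + of_int k * X"
        by (auto simp: config_set_def circle_interval_def)
      then have xi: "x \<in> circle_interval X (a i) (b i)" by (auto simp: circle_interval_def)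
      have "u x = u (x - of_int k * X)" using per_int[of "x - of_int k * X" k] by simp
      also have "\<dots> = c i * arc_mode X a b \<mu> i x"
        using c[OF i, of "x - of_int k * X"] k
          periodic_piece_eq[OF \<open>X > 0\<close> interval_configD(2)[OF cfg i] k] by simp
      \<comment> \<open>If the arc \<open>i\<close> is not resonant, the sum has no term for it, and
        \<open>c0\<close> makes the left side zero too.\<close>
      also have "\<dots> = (\<Sum>j\<in>?I. if j = i then c i * arc_mode X a b \<mu> i x else 0)"
        using c0[OF i] by (auto simp: sum.delta)
      also have "\<dots> = (\<Sum>j\<in>?I. c j * arc_mode X a b \<mu> j x)"
      proof (rule sum.cong)
        fix j assume "j \<in> ?I"
        then show "(if j = i then c i * arc_mode X a b \<mu> i x else 0) = c j * arc_mode X a b \<mu> j x"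
          using interval_config_disjoint[OF cfg i _ _ xi, of j]
          by (auto simp: resonant_arcs_def periodic_piece_outside)
      qed simp
      finally show ?thesis by (simp add: sum_fun_scaled_apply)
    next
      case False
      then have "arc_mode X a b \<mu> i x = 0" if "i \<in> ?I" for i
        using that by (auto simp: resonant_arcs_def config_set_def periodic_piece_outside)
      then show ?thesis using out[OF False] by (simp add: sum_fun_scaled_apply)
    qed
  qed
  also have "\<dots> \<in> real_fun.span (arc_mode X a b \<mu> ` ?I)"
    by (intro real_fun.span_sum real_fun.span_scale real_fun.span_base imageI)
  finally show "u \<in> real_fun.span (arc_mode X a b \<mu> ` ?I)" .
qed

lemma dirichlet_multiplicity_config_set:
  assumes "X > 0" "interval_config X m a b"
  shows "dirichlet_multiplicity X (config_set X m a b) \<mu> = card (resonant_arcs m a b \<mu>)"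
  unfolding dirichlet_multiplicity_def
proof (rule real_fun.dim_unique)
  show "arc_mode X a b \<mu> ` resonant_arcs m a b \<mu> \<subseteq> dirichlet_eigenspace X (config_set X m a b) \<mu>"
    using arc_mode_in_eigenspace[OF assms] by (rule image_subsetI)
qed (rule eigenspace_subset_span_arc_modes[OF assms] independent_arc_modes[OF assms]
      card_image[OF inj_arc_mode[OF assms]])+

lemma dirichlet_spectrum_config_set:
  assumes "X > 0" "interval_config X m a b"
  shows "dirichlet_spectrum X (config_set X m a b) = (\<Union>i<m. interval_dirichlet_spectrum (b i - a i))"
proof -
  have "\<mu> \<in> dirichlet_spectrum X (config_set X m a b) \<longleftrightarrow> resonant_arcs m a b \<mu> \<noteq> {}" for \<mu>
  proof
    assume "\<mu> \<in> dirichlet_spectrum X (config_set X m a b)"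
    \<comment> \<open>Without resonant arcs the eigenspace lies in the span of the empty set, which
      contains only the zero function.\<close>
    then show "resonant_arcs m a b \<mu> \<noteq> {}"
      using eigenspace_subset_span_arc_modes[OF assms, of \<mu>]
      by (auto simp: dirichlet_spectrum_def zero_fun_def)
  next
    assume "resonant_arcs m a b \<mu> \<noteq> {}"
    then obtain i where i: "i \<in> resonant_arcs m a b \<mu>" by blast
    have "arc_mode X a b \<mu> i \<noteq> (\<lambda>_. 0)"
      using arc_mode_peak[OF assms i] by (metis zero_neq_one)
    then show "\<mu> \<in> dirichlet_spectrum X (config_set X m a b)"
      using arc_mode_in_eigenspace[OF assms i] unfolding dirichlet_spectrum_def by blast
  qed
  then show ?thesis by (auto simp: resonant_arcs_def)
qed

text \<open>Double counting of the pairs of an eigenvalue up to \<open>t\<close> and an arc that has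
  it: summed by eigenvalues they give the multiplicities, summed by arcs the floors.\<close>

lemma dirichlet_count_config_set:
  assumes "X > 0" and cfg: "interval_config X m a b"
  shows "dirichlet_count X (config_set X m a b) t = (\<Sum>i<m. nat \<lfloor>sqrt t * (b i - a i) / pi\<rfloor>)"
proof -
  let ?D = "\<lambda>i. interval_dirichlet_spectrum (b i - a i)"
  define M where "M = (\<Union>i<m. ?D i \<inter> {..t})"
  have l: "b i - a i > 0" if "i < m" for i using interval_configD(1)[OF cfg that] by simp
  have "finite M"
    unfolding M_def
    by (rule finite_UN_I[OF finite_lessThan finite_interval_dirichlet_spectrum_atMost[OF l]]) simp
  have "{\<mu> \<in> dirichlet_spectrum X (config_set X m a b). \<mu> \<le> t} = M"
    unfolding dirichlet_spectrum_config_set[OF assms] by (auto simp: M_def)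
  then have "dirichlet_count X (config_set X m a b) t = (\<Sum>\<mu>\<in>M. card {i\<in>{..<m}. \<mu> \<in> ?D i})"
    by (simp add: dirichlet_count_def dirichlet_multiplicity_config_set[OF assms] resonant_arcs_def)
  also have "\<dots> = (\<Sum>i<m. card {\<mu>\<in>M. \<mu> \<in> ?D i})"
    by (rule sum_multicount_gen) (use \<open>finite M\<close> in simp_all)
  also have "\<dots> = (\<Sum>i<m. nat \<lfloor>sqrt t * (b i - a i) / pi\<rfloor>)"
  proof (rule sum.cong)
    fix i assume "i \<in> {..<m}"
    moreover from this have "{\<mu>\<in>M. \<mu> \<in> ?D i} = ?D i \<inter> {..t}" by (auto simp: M_def)
    ultimately show "card {\<mu>\<in>M. \<mu> \<in> ?D i} = nat \<lfloor>sqrt t * (b i - a i) / pi\<rfloor>"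
      using card_interval_dirichlet_spectrum_atMost[OF l] by simp
  qed simp
  finally show ?thesis .
qed

section \<open>The gap ratio\<close>

text \<open>No arc is longer than \<open>X\<close>, so no eigenvalue lies below the first one of an
  interval of length \<open>X\<close>. This makes the infima meaningful and the denominator of the
  ratio positive.\<close>

lemma dirichlet_count_ge_one_imp:
  assumes "X > 0" and cfg: "interval_config X m a b"
    and "dirichlet_count X (config_set X m a b) t \<ge> 1"
  shows "t \<ge> (pi / X)\<^sup>2"
proof -
  have "(\<Sum>i<m. nat \<lfloor>sqrt t * (b i - a i) / pi\<rfloor>) \<noteq> 0"
    using assms(3) unfolding dirichlet_count_config_set[OF assms(1,2)] by linarith
  then obtain i where i: "i < m" "nat \<lfloor>sqrt t * (b i - a i) / pi\<rfloor> \<noteq> 0"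
    by (rule sum.not_neutral_contains_not_neutral) simp
  note l = interval_configD[OF cfg i(1)]
  have "1 \<le> nat \<lfloor>sqrt t * (b i - a i) / pi\<rfloor>" using i(2) by linarith
  then have "1 \<le> sqrt t * (b i - a i) / pi" using nat_floor_ge_iff[of 1] by simp
  then have 1: "pi \<le> sqrt t * (b i - a i)" by (simp add: field_simps)
  then have "0 < sqrt t * (b i - a i)" using pi_gt_zero by linarith
  then have "0 < sqrt t" using l by (simp add: zero_less_mult_iff)
  then have "sqrt t * (b i - a i) \<le> sqrt t * X" using l by (intro mult_left_mono) auto
  then have "pi / X \<le> sqrt t" using 1 \<open>X > 0\<close> by (simp add: field_simps)
  then have "(pi / X)\<^sup>2 \<le> (sqrt t)\<^sup>2" using \<open>X > 0\<close> by (intro power_mono) auto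
  then show ?thesis using \<open>0 < sqrt t\<close> by simp
qed

text \<open>Each floor has an argument proportional to \<open>sqrt t\<close>, which doubles when
  \<open>t\<close> is quadrupled, and the floor of 2y is at least twice the floor of y. Negative
  floors are harmless because \<open>nat\<close> sends them to 0.\<close>

lemma dirichlet_count_quadruple:
  assumes "X > 0" "interval_config X m a b"
  shows "2 * dirichlet_count X (config_set X m a b) t \<le> dirichlet_count X (config_set X m a b) (4 * t)"
proof -
  have "2 * nat \<lfloor>y\<rfloor> \<le> nat \<lfloor>2 * y\<rfloor>" for y :: real
  proof (cases "\<lfloor>y\<rfloor> \<ge> 0")
    case True
    have "2 * \<lfloor>y\<rfloor> \<le> \<lfloor>2 * y\<rfloor>" by (simp add: le_floor_iff)
    then show ?thesis using True by linarith
  qed simp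
  from this[of "sqrt t * (b i - a i) / pi" for i] show ?thesis
    by (auto simp: dirichlet_count_config_set[OF assms] sum_distrib_left real_sqrt_mult mult.assoc
        intro!: sum_mono)
qed

text \<open>Arc 0 alone already supplies \<open>n\<close> eigenvalues up to its own
  \<open>n\<close>-th one. This keeps the sets whose infima are the eigenvalues nonempty.\<close>

lemma dirichlet_count_unbounded:
  assumes "X > 0" and cfg: "interval_config X m a b" and "m \<ge> 1"
  shows "\<exists>t. n \<le> dirichlet_count X (config_set X m a b) t"
proof -
  define t where "t = (real n * pi / (b 0 - a 0))\<^sup>2"
  have l: "b 0 - a 0 > 0" using interval_configD(1)[OF cfg, of 0] \<open>m \<ge> 1\<close> by simp
  then have "nat \<lfloor>sqrt t * (b 0 - a 0) / pi\<rfloor> = n" by (simp add: t_def)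
  moreover have "nat \<lfloor>sqrt t * (b 0 - a 0) / pi\<rfloor> \<le> (\<Sum>i<m. nat \<lfloor>sqrt t * (b i - a i) / pi\<rfloor>)"
    using \<open>m \<ge> 1\<close> by (intro member_le_sum) auto
  ultimately show ?thesis
    using dirichlet_count_config_set[OF assms(1,2)] by metis
qed

lemma gap_ratio_le:
  assumes "X > 0" and cfg: "interval_config X m a b" and "m \<ge> 1"
  shows "gap_ratio X m (config_set X m a b) \<le> 6 / 5"
proof -
  let ?N = "dirichlet_count X (config_set X m a b)"
  define S where "S n = {t. n \<le> ?N t}" for n
  define p q where "p = Inf (S m)" and "q = Inf (S (m + 1))"
  have ne: "S n \<noteq> {}" for n using dirichlet_count_unbounded[OF assms] by (auto simp: S_def)
  have lb: "t \<ge> (pi / X)\<^sup>2" if "t \<in> S n" "n \<ge> 1" for t n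
    using dirichlet_count_ge_one_imp[OF assms(1,2), of t] that by (simp add: S_def)
  then have bdd: "bdd_below (S n)" if "n \<ge> 1" for n using that by (intro bdd_belowI) auto
  have "p \<ge> (pi / X)\<^sup>2" unfolding p_def by (intro cInf_greatest[OF ne] lb[OF _ \<open>m \<ge> 1\<close>])
  moreover have "(pi / X)\<^sup>2 > 0" using \<open>X > 0\<close> by simp
  ultimately have "p > 0" by linarith
  have "q \<ge> p" unfolding p_def q_def
    by (rule cInf_superset_mono[OF ne bdd[OF \<open>m \<ge> 1\<close>]]) (auto simp: S_def)
  \<comment> \<open>Comparing \<open>q / 4\<close> with every element of \<open>S m\<close> makes it
    unnecessary to know that the infimum is attained.\<close>
  have "q / 4 \<le> p" unfolding p_def
  proof (rule cInf_greatest[OF ne])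
    fix t assume "t \<in> S m"
    then have "4 * t \<in> S (m + 1)"
      using dirichlet_count_quadruple[OF assms(1,2), of t] \<open>m \<ge> 1\<close> by (simp add: S_def)
    then have "q \<le> 4 * t" unfolding q_def by (intro cInf_lower bdd) auto
    then show "q / 4 \<le> t" by simp
  qed
  \<comment> \<open>After multiplication by the positive \<open>q + p\<close> the claim is exactly
    \<open>q \<le> 4 * p\<close>.\<close>
  then show ?thesis
    using \<open>p > 0\<close> \<open>q \<ge> p\<close>
    by (simp add: gap_ratio_def dirichlet_eigenvalue_def S_def p_def q_def divide_simps)
qed

lemma gap_ratio_equal_lengths:
  assumes "X > 0" and cfg: "interval_config X m a b" and "m \<ge> 1"
    and eq: "\<forall>i<m. \<forall>j<m. b i - a i = b j - a j"
  shows "gap_ratio X m (config_set X m a b) = 6 / 5"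
proof -
  define l where "l = b 0 - a 0"
  have "l > 0" using interval_configD(1)[OF cfg, of 0] \<open>m \<ge> 1\<close> by (simp add: l_def)
  have N: "dirichlet_count X (config_set X m a b) t = m * nat \<lfloor>sqrt t * l / pi\<rfloor>" for t
  proof -
    have "(\<Sum>i<m. nat \<lfloor>sqrt t * (b i - a i) / pi\<rfloor>) = (\<Sum>i<m. nat \<lfloor>sqrt t * l / pi\<rfloor>)"
    proof (rule sum.cong)
      fix i assume "i \<in> {..<m}"
      then have "b i - a i = l"
        unfolding l_def using \<open>m \<ge> 1\<close> by (intro eq[rule_format]) auto
      then show "nat \<lfloor>sqrt t * (b i - a i) / pi\<rfloor> = nat \<lfloor>sqrt t * l / pi\<rfloor>" by simp
    qed simp
    then show ?thesis by (simp add: dirichlet_count_config_set[OF assms(1,2)])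
  qed
  have level: "n \<le> nat \<lfloor>sqrt t * l / pi\<rfloor> \<longleftrightarrow> (real n * pi / l)\<^sup>2 \<le> t" if "n \<ge> 1" for n t
  proof -
    have "n \<le> nat \<lfloor>sqrt t * l / pi\<rfloor> \<longleftrightarrow> real n * pi / l \<le> sqrt t"
      using nat_floor_ge_iff[OF that] \<open>l > 0\<close> by (simp add: field_simps)
    also have "\<dots> \<longleftrightarrow> sqrt ((real n * pi / l)\<^sup>2) \<le> sqrt t" using \<open>l > 0\<close> by simp
    finally show ?thesis by (simp only: real_sqrt_le_iff)
  qed
  have "{t. m \<le> m * nat \<lfloor>sqrt t * l / pi\<rfloor>} = {t. 1 \<le> nat \<lfloor>sqrt t * l / pi\<rfloor>}"
    using \<open>m \<ge> 1\<close> by auto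
  also have "\<dots> = {(pi / l)\<^sup>2..}" using level[of 1] by auto
  finally have p: "dirichlet_eigenvalue X (config_set X m a b) m = (pi / l)\<^sup>2"
    by (simp add: dirichlet_eigenvalue_def N)
  \<comment> \<open>The count moves in steps of \<open>m\<close>, so exceeding \<open>m\<close> by
    one already requires the second level of the common interval.\<close>
  have "m + 1 \<le> m * k \<longleftrightarrow> 2 \<le> k" for k
  proof
    assume "m + 1 \<le> m * k"
    then have "m * 1 < m * k" by linarith
    then have "1 < k" unfolding mult_less_cancel1 by blast
    then show "2 \<le> k" by linarith
  next
    assume "2 \<le> k"
    then have "m * 2 \<le> m * k" by (rule mult_le_mono2)
    then show "m + 1 \<le> m * k" using \<open>m \<ge> 1\<close> by linarith
  qed
  then have "{t. m + 1 \<le> m * nat \<lfloor>sqrt t * l / pi\<rfloor>} = {(2 * pi / l)\<^sup>2..}"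
    using level[of 2] by auto
  then have q: "dirichlet_eigenvalue X (config_set X m a b) (m + 1) = 4 * (pi / l)\<^sup>2"
    by (simp add: dirichlet_eigenvalue_def N power_divide power_mult_distrib)
  have "(pi / l)\<^sup>2 > 0" using \<open>l > 0\<close> by simp
  moreover have "2 * ((4 * y - y) / (4 * y + y)) = 6 / 5" if "y > 0" for y :: real
    using that by (simp add: divide_simps)
  ultimately show ?thesis unfolding gap_ratio_def p q by blast
qed

text \<open>Without a witness, attainment of the maximum would be vacuous. The circle is cut into
  \<open>m\<close> cells of length \<open>h\<close>, and the left half of each cell is
  taken.\<close>

lemma equal_interval_unions_nonempty:
  assumes "m \<ge> 1" "X > 0"
  shows "equal_interval_unions X m \<noteq> {}"
proof -
  define h where "h = X / real m"
  have h: "h > 0" "X = real m * h" "h \<le> X" using assms by (auto simp: h_def field_simps)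
  define a b where "a i = real i * h" and "b i = real i * h + h / 2" for i
  have far: "\<bar>x - y\<bar> \<ge> h / 2"
    if ij: "i < m" "j < m" "i \<noteq> j" and x: "x \<in> circle_interval X (a i) (b i)"
      and y: "y \<in> circle_interval X (a j) (b j)" for i j x y
  proof -
    obtain k k' :: int where k: "a i + of_int k * X < x" "x < b i + of_int k * X"
      "a j + of_int k' * X < y" "y < b j + of_int k' * X"
      using x y by (auto simp: circle_interval_def)
    \<comment> \<open>As \<open>X = real m * h\<close>, the left ends of the two translates differ
      by \<open>d\<close> times \<open>h\<close>; \<open>d = 0\<close> would make i and j congruent
      modulo \<open>m\<close>.\<close>
    define d where "d = int i - int j + (k - k') * int m"
    have "d \<noteq> 0"
    proof
      assume "d = 0"
      then have "int i mod int m = int j mod int m"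
        unfolding d_def mod_eq_dvd_iff by (simp add: dvd_def) (metis mult.commute mult_minus_left add.commute eq_neg_iff_add_eq_0)
      then show False using ij by simp
    qed
    have "real_of_int d * h = (a i + of_int k * X) - (a j + of_int k' * X)"
      by (simp add: d_def a_def h(2) algebra_simps)
    \<comment> \<open>Both points lie less than \<open>h / 2\<close> to the right of their left
      ends, so these offsets differ by less than \<open>h / 2\<close>.\<close>
    then have close: "\<bar>(x - y) - real_of_int d * h\<bar> < h / 2"
      using k unfolding a_def b_def abs_less_iff by linarith
    have "1 * h \<le> \<bar>real_of_int d\<bar> * h" using \<open>d \<noteq> 0\<close> h by (intro mult_right_mono) linarith+
    then have "h \<le> \<bar>real_of_int d * h\<bar>" using h by (simp add: abs_mult)
    then show ?thesis using close by linarith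
  qed
  have "interval_config X m a b"
    unfolding interval_config_def
  proof (intro conjI allI impI)
    fix i j assume ij: "i < m" "j < m" "i \<noteq> j"
    show "closure (circle_interval X (a i) (b i)) \<inter> closure (circle_interval X (a j) (b j)) = {}"
    proof (rule ccontr)
      assume "\<not> ?thesis"
      then obtain z where z: "z \<in> closure (circle_interval X (a i) (b i))"
        "z \<in> closure (circle_interval X (a j) (b j))" by blast
      obtain x y where "x \<in> circle_interval X (a i) (b i)" "dist x z < h / 4"
        "y \<in> circle_interval X (a j) (b j)" "dist y z < h / 4"
        using z h(1) unfolding closure_approachable by (metis divide_pos_pos zero_less_numeral)
      with far[OF ij, of x y] show False unfolding dist_real_def by linarith
    qed
  qed (use h in \<open>auto simp: a_def b_def\<close>)
  moreover have "\<forall>i<m. \<forall>j<m. b i - a i = b j - a j" by (simp add: a_def b_def)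
  ultimately show ?thesis unfolding equal_interval_unions_def by blast
qed

theorem proposition2p13:
  fixes m :: nat and X :: real
  assumes "m \<ge> 1" and "X > 0"
  shows "equal_interval_unions X m \<noteq> {} \<and>
    (\<forall>\<Omega> \<in> equal_interval_unions X m.
       is_arg_max (gap_ratio X m) (\<lambda>\<Omega>. \<Omega> \<in> interval_unions X m) \<Omega> \<and>
       gap_ratio X m \<Omega> = 6 / 5)"
proof (intro conjI ballI)
  show "equal_interval_unions X m \<noteq> {}" using equal_interval_unions_nonempty[OF assms] .
  fix \<Omega> assume "\<Omega> \<in> equal_interval_unions X m"
  then obtain a b where \<Omega>: "\<Omega> = config_set X m a b" and cfg: "interval_config X m a b"
    and eq: "\<forall>i<m. \<forall>j<m. b i - a i = b j - a j"
    by (auto simp: equal_interval_unions_def)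
  show "gap_ratio X m \<Omega> = 6 / 5"
    unfolding \<Omega> using gap_ratio_equal_lengths[OF assms(2) cfg assms(1) eq] .
  moreover have "\<Omega> \<in> interval_unions X m" using \<Omega> cfg by (auto simp: interval_unions_def)
  moreover have "gap_ratio X m \<Omega>' \<le> 6 / 5" if "\<Omega>' \<in> interval_unions X m" for \<Omega>'
    using that gap_ratio_le[OF assms(2) _ assms(1)] by (auto simp: interval_unions_def)
  ultimately show "is_arg_max (gap_ratio X m) (\<lambda>\<Omega>. \<Omega> \<in> interval_unions X m) \<Omega>"
    unfolding is_arg_max_def by (simp only: not_less not_ex de_Morgan_conj) blast
qed

end
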